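(* Let $H\in M_N(\mathbb C)$ be a complex Hadamard matrix and $U=H/\sqrt N$. Consider $$E_U=\{B\in M_N(\mathbb C):B=B^*,\ \Phi(U,B)=0\}$$ and $$D_U=\Big\{A\in M_N(\mathbb R):\sum_k\overline{U_{ki}}U_{kj}(A_{ki}-A_{kj})=0\ \text{for all } i,j\Big\}.$$ The map $B\mapsto\left[(UB)_{ij}\overline{U_{ij}}\right]_{ij}$ is an isomorphism of real vector spaces from $E_U$ onto $D_U$. In particular $\dim_{\mathbb R}E_U=\dim_{\mathbb R}D_U$.
   Context: A complex Hadamard matrix is an $N\times N$ matrix whose entries all have modulus $1$ and whose rows are pairwise orthogonal. For $U\in U(N)$ with all entries nonzero, let $S_{ij}=U_{ij}/|U_{ij}|$ and $X=S^*U$. For hermitian $B$ define $$\Phi(U,B)=\mathrm{Tr}(XB^2)-\sum_{i,j}\frac{\mathrm{Re}\left[(UB)_{ij}\overline{S_{ij}}\right]^2}{|U_{ij}|}.$$ *)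

theory Defs
  imports "HOL-Analysis.Analysis"
begin

text \<open>The matrices of \<open>M\<^sub>N(\<complex>)\<close> are elements of \<^typ>\<open>complex^'n^'n\<close>, with \<open>N = CARD('n)\<close>.\<close>

definition conj_transpose :: "complex^'n^'m \<Rightarrow> complex^'m^'n" where
  "conj_transpose A = (\<chi> i j. cnj (A $ j $ i))"

definition hermitian_matrix :: "complex^'n^'n \<Rightarrow> bool" where
  "hermitian_matrix B \<longleftrightarrow> B = conj_transpose B"

definition complex_hadamard :: "complex^'n^'n \<Rightarrow> bool" where
  "complex_hadamard H \<longleftrightarrow>
     (\<forall>i j. cmod (H $ i $ j) = 1) \<and>
     (\<forall>i j. i \<noteq> j \<longrightarrow> (\<Sum>k\<in>UNIV. H $ i $ k * cnj (H $ j $ k)) = 0)"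

definition phase_matrix :: "complex^'n^'n \<Rightarrow> complex^'n^'n" where
  "phase_matrix U = (\<chi> i j. U $ i $ j / complex_of_real (cmod (U $ i $ j)))"

text \<open>\<open>\<Phi>(U,B)\<close> is complex-valued, since for a general unitary \<open>U\<close> the matrix \<open>X = S\<^sup>*U\<close> need not
  be hermitian. The square in the sum is that of the real part. The formula is meant for unitary
  \<open>U\<close> without zero entries and for hermitian \<open>B\<close>.\<close>

definition Phi :: "complex^'n^'n \<Rightarrow> complex^'n^'n \<Rightarrow> complex" where
  "Phi U B =
     (let S = phase_matrix U; X = conj_transpose S ** U
      in trace (X ** (B ** B)) -
         complex_of_real
           (\<Sum>i\<in>UNIV. \<Sum>j\<in>UNIV. (Re ((U ** B) $ i $ j * cnj (S $ i $ j)))\<^sup>2 / cmod (U $ i $ j)))"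

definition E_space :: "complex^'n^'n \<Rightarrow> (complex^'n^'n) set" where
  "E_space U = {B. hermitian_matrix B \<and> Phi U B = 0}"

definition D_space :: "complex^'n^'n \<Rightarrow> (real^'n^'n) set" where
  "D_space U =
     {A. \<forall>i j. (\<Sum>k\<in>UNIV. cnj (U $ k $ i) * U $ k $ j * complex_of_real (A $ k $ i - A $ k $ j)) = 0}"

definition real_iso_between ::
    "('a::real_vector \<Rightarrow> 'b::real_vector) \<Rightarrow> 'a set \<Rightarrow> 'b set \<Rightarrow> bool" where
  "real_iso_between f V W \<longleftrightarrow>
     subspace V \<and> subspace W \<and>
     (\<forall>x\<in>V. \<forall>y\<in>V. f (x + y) = f x + f y) \<and>
     (\<forall>c. \<forall>x\<in>V. f (c *\<^sub>R x) = c *\<^sub>R f x) \<and>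
     bij_betw f V W"

end

theory Submission
  imports Defs
begin

text \<open>If all entries of a unitary \<open>U\<close> have modulus \<open>1/s\<close>, then \<open>X = s I\<close>, and unitarity of \<open>U\<close>
  turns \<open>Tr(B\<^sup>2)\<close> into the sum of the squared moduli of the entries of \<open>UB\<close>. Hence \<open>\<Phi>(U,B)\<close> equals
  \<open>s\<^sup>3\<close> times the sum of the squared imaginary parts of the numbers \<open>(UB)\<^sub>i\<^sub>j cnj U\<^sub>i\<^sub>j\<close>, and it vanishes
  iff all of these are real. A real matrix \<open>A\<close> arises in this way from the single candidate
  \<open>B = U\<^sup>* [s\<^sup>2 A\<^sub>i\<^sub>j U\<^sub>i\<^sub>j]\<close>, and hermiticity of this candidate is the defining equation of \<open>D\<^sub>U\<close>.\<close>

lemma conj_transpose_mult: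
  "conj_transpose (A ** B) = conj_transpose B ** conj_transpose A"
  by (simp add: vec_eq_iff conj_transpose_def matrix_matrix_mult_def mult.commute)

lemma hermitian_matrix_add:
  assumes "hermitian_matrix A" and "hermitian_matrix B"
  shows "hermitian_matrix (A + B)"
proof -
  have "conj_transpose (A + B) = conj_transpose A + conj_transpose B"
    by (simp add: vec_eq_iff conj_transpose_def)
  then show ?thesis
    using assms unfolding hermitian_matrix_def by argo
qed

lemma hermitian_matrix_scaleR:
  assumes "hermitian_matrix A"
  shows "hermitian_matrix (c *\<^sub>R A)"
proof -
  have "conj_transpose (c *\<^sub>R A) = c *\<^sub>R conj_transpose A"
    by (simp add: vec_eq_iff conj_transpose_def)
  then show ?thesis
    using assms unfolding hermitian_matrix_def by argo
qed

text \<open>The squared Frobenius norm: applied to \<open>U ** B\<close> it supplies the squared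
  moduli from which squared real parts are subtracted in \<open>Phi\<close>.\<close>

lemma trace_conj_transpose_mult_self:
  "trace (conj_transpose A ** A) = complex_of_real (\<Sum>i\<in>UNIV. \<Sum>j\<in>UNIV. (cmod (A $ i $ j))\<^sup>2)"
proof -
  have "trace (conj_transpose A ** A) =
      (\<Sum>j\<in>UNIV. \<Sum>i\<in>UNIV. complex_of_real ((cmod (A $ i $ j))\<^sup>2))"
    unfolding trace_def matrix_matrix_mult_def conj_transpose_def
    by (simp add: complex_norm_square mult.commute del: of_real_power)
  also have "\<dots> = (\<Sum>i\<in>UNIV. \<Sum>j\<in>UNIV. complex_of_real ((cmod (A $ i $ j))\<^sup>2))"
    by (rule sum.swap)
  finally show ?thesis by simp
qed

text \<open>Orthogonality of the rows yields \<open>U ** conj_transpose U = mat 1\<close>. For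
  square matrices a right inverse is also a left inverse, which gives the column version used
  below.\<close>

lemma hadamard_unitary:
  fixes H U :: "complex^'n^'n"
  assumes "complex_hadamard H" and U: "U = (1 / sqrt (real CARD('n))) *\<^sub>R H"
  shows "cmod (U $ i $ j) = 1 / sqrt (real CARD('n))"
    and "conj_transpose U ** U = mat 1"
proof -
  let ?N = "real CARD('n)"
  have norm: "cmod (H $ i $ j) = 1" for i j
    using assms by (auto simp: complex_hadamard_def)
  have orth: "i \<noteq> j \<Longrightarrow> (\<Sum>k\<in>UNIV. H $ i $ k * cnj (H $ j $ k)) = 0" for i j
    using assms by (auto simp: complex_hadamard_def)
  show "cmod (U $ i $ j) = 1 / sqrt ?N"
    by (simp add: U norm)
  have diag: "H $ i $ k * cnj (H $ i $ k) = 1" for i k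
    using complex_norm_square[of "H $ i $ k"] norm by simp
  have entry: "U $ i $ k * cnj (U $ j $ k) = (1 / ?N) *\<^sub>R (H $ i $ k * cnj (H $ j $ k))" for i j k
    by (simp add: U)
  have "(U ** conj_transpose U) $ i $ j = (mat 1 :: complex^'n^'n) $ i $ j" for i j
    unfolding matrix_matrix_mult_def conj_transpose_def mat_def
    by (simp add: entry diag orth flip: scaleR_sum_right) (simp add: scaleR_conv_of_real)
  then have "U ** conj_transpose U = mat 1"
    by (simp add: vec_eq_iff)
  then show "conj_transpose U ** U = mat 1"
    by (simp add: matrix_left_right_inverse)
qed

lemma Phi_eq_sum_Im_squares:
  fixes U B :: "complex^'n^'n"
  assumes s: "s > 0" and norm: "\<And>i j. cmod (U $ i $ j) = 1 / s"
    and unitary: "conj_transpose U ** U = mat 1" and B: "hermitian_matrix B"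
  shows "Phi U B = complex_of_real
    (s ^ 3 * (\<Sum>i\<in>UNIV. \<Sum>j\<in>UNIV. (Im ((U ** B) $ i $ j * cnj (U $ i $ j)))\<^sup>2))"
proof -
  let ?W = "\<lambda>i j. (U ** B) $ i $ j * cnj (U $ i $ j)"
  have S: "phase_matrix U $ i $ j = s *\<^sub>R U $ i $ j" for i j
    using s by (simp add: phase_matrix_def norm scaleR_conv_of_real)
  have "conj_transpose (phase_matrix U) ** U = s *\<^sub>R (conj_transpose U ** U)"
    by (simp add: vec_eq_iff conj_transpose_def matrix_matrix_mult_def S scaleR_sum_right)
  then have "conj_transpose (phase_matrix U) ** U ** (B ** B) = s *\<^sub>R (B ** B)"
    by (simp add: unitary flip: scalar_matrix_assoc)
  moreover have "trace (B ** B) = complex_of_real (\<Sum>i\<in>UNIV. \<Sum>j\<in>UNIV. (cmod ((U ** B) $ i $ j))\<^sup>2)"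
  proof -
    \<comment> \<open>Hermiticity of \<open>B\<close> lets its adjoint stand for the left factor of
      \<open>B ** B\<close>, and \<open>U\<^sup>*U\<close> can then be inserted between the
      factors.\<close>
    have "conj_transpose (U ** B) ** (U ** B) = conj_transpose B ** (conj_transpose U ** U) ** B"
      by (simp add: conj_transpose_mult matrix_mul_assoc)
    also have "\<dots> = B ** B"
      using B by (simp add: unitary hermitian_matrix_def)
    finally show ?thesis
      by (metis trace_conj_transpose_mult_self)
  qed
  ultimately have tr: "trace (conj_transpose (phase_matrix U) ** U ** (B ** B)) =
      complex_of_real (\<Sum>i\<in>UNIV. \<Sum>j\<in>UNIV. s * (cmod ((U ** B) $ i $ j))\<^sup>2)"
    by (simp add: trace_def flip: sum_distrib_left scaleR_sum_right) (simp add: scaleR_conv_of_real)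
  \<comment> \<open>Multiplying by \<open>cnj (U $ i $ j)\<close> divides the modulus by
    \<open>s\<close>, so passing to \<open>?W\<close> costs a factor
    \<open>s\<^sup>2\<close>.\<close>
  have "s * (cmod ((U ** B) $ i $ j))\<^sup>2 = s ^ 3 * (cmod (?W i j))\<^sup>2" for i j
    using s by (simp add: norm_mult norm power_mult_distrib power_divide field_simps eval_nat_numeral)
  \<comment> \<open>Two powers of \<open>s\<close> come from squaring the phase
    \<open>s *\<^sub>R U $ i $ j\<close>, the third from dividing by the modulus
    \<open>1 / s\<close>.\<close>
  moreover have "(Re ((U ** B) $ i $ j * cnj (phase_matrix U $ i $ j)))\<^sup>2 / cmod (U $ i $ j) =
      s ^ 3 * (Re (?W i j))\<^sup>2" for i j
  proof -
    have "(U ** B) $ i $ j * cnj (phase_matrix U $ i $ j) = s *\<^sub>R ?W i j"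
      by (simp add: S)
    then have "Re ((U ** B) $ i $ j * cnj (phase_matrix U $ i $ j)) = s * Re (?W i j)"
      by (metis scaleR_complex.sel(1))
    then show ?thesis
      by (simp add: norm power_mult_distrib eval_nat_numeral)
  qed
  ultimately have "Phi U B = complex_of_real ((\<Sum>i\<in>UNIV. \<Sum>j\<in>UNIV. s ^ 3 * (cmod (?W i j))\<^sup>2) -
      (\<Sum>i\<in>UNIV. \<Sum>j\<in>UNIV. s ^ 3 * (Re (?W i j))\<^sup>2))"
    unfolding Phi_def Let_def tr of_real_diff by presburger
  also have "(\<Sum>i\<in>UNIV. \<Sum>j\<in>UNIV. s ^ 3 * (cmod (?W i j))\<^sup>2) -
      (\<Sum>i\<in>UNIV. \<Sum>j\<in>UNIV. s ^ 3 * (Re (?W i j))\<^sup>2) =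
      s ^ 3 * (\<Sum>i\<in>UNIV. \<Sum>j\<in>UNIV. (Im (?W i j))\<^sup>2)"
    unfolding sum_subtractf[symmetric] right_diff_distrib[symmetric] sum_distrib_left cmod_power2
      add_diff_cancel_left' ..
  finally show ?thesis .
qed

text \<open>A sum of squares vanishes only termwise. This trades the quadratic equation
  \<open>Phi U B = 0\<close> for real-linear conditions on \<open>B\<close>.\<close>

lemma E_space_flat_unitary:
  assumes "s > 0" and "\<And>i j. cmod (U $ i $ j) = 1 / s" and "conj_transpose U ** U = mat 1"
  shows "E_space U =
    {B. hermitian_matrix B \<and> (\<forall>i j. Im ((U ** B) $ i $ j * cnj (U $ i $ j)) = 0)}"
proof -
  have "Phi U B = 0 \<longleftrightarrow> (\<forall>i j. Im ((U ** B) $ i $ j * cnj (U $ i $ j)) = 0)"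
    if "hermitian_matrix B" for B
    unfolding Phi_eq_sum_Im_squares[OF assms that] of_real_eq_0_iff
    using \<open>s > 0\<close> by (simp add: sum_nonneg_eq_0_iff sum_nonneg del: times_complex.sel)
  then show ?thesis
    by (auto simp: E_space_def)
qed

text \<open>Taking \<open>Re\<close> makes the map real-valued and real-linear on all matrices; on
  \<open>E_space U\<close> it discards nothing when \<open>U\<close> is a flat unitary.\<close>

definition flat_coords :: "complex^'n^'n \<Rightarrow> complex^'n^'n \<Rightarrow> real^'n^'n" where
  "flat_coords U B = (\<chi> i j. Re ((U ** B) $ i $ j * cnj (U $ i $ j)))"

lemma linear_flat_coords: "linear (flat_coords U)"
  by (rule linearI)
    (simp_all add: flat_coords_def vec_eq_iff matrix_add_ldistrib matrix_scalar_ac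
      algebra_simps flip: scalar_matrix_assoc)

lemma subspace_D_space: "subspace (D_space U)"
proof (rule subspaceI)
  fix A B and c :: real
  assume A: "A \<in> D_space U"
  show "c *\<^sub>R A \<in> D_space U"
    unfolding D_space_def
  proof (intro CollectI allI)
    fix i j
    have "(\<Sum>k\<in>UNIV. cnj (U $ k $ i) * U $ k $ j * complex_of_real ((c *\<^sub>R A) $ k $ i - (c *\<^sub>R A) $ k $ j))
      = c *\<^sub>R (\<Sum>k\<in>UNIV. cnj (U $ k $ i) * U $ k $ j * complex_of_real (A $ k $ i - A $ k $ j))"
      unfolding scaleR_sum_right
      by (intro sum.cong refl) (simp add: scaleR_conv_of_real[where 'a = complex] algebra_simps)
    then show "(\<Sum>k\<in>UNIV. cnj (U $ k $ i) * U $ k $ j * complex_of_real ((c *\<^sub>R A) $ k $ i - (c *\<^sub>R A) $ k $ j)) = 0"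
      using A by (simp add: D_space_def)
  qed
  assume B: "B \<in> D_space U"
  show "A + B \<in> D_space U"
    unfolding D_space_def
  proof (intro CollectI allI)
    fix i j
    have "(\<Sum>k\<in>UNIV. cnj (U $ k $ i) * U $ k $ j * complex_of_real ((A + B) $ k $ i - (A + B) $ k $ j))
      = (\<Sum>k\<in>UNIV. cnj (U $ k $ i) * U $ k $ j * complex_of_real (A $ k $ i - A $ k $ j))
      + (\<Sum>k\<in>UNIV. cnj (U $ k $ i) * U $ k $ j * complex_of_real (B $ k $ i - B $ k $ j))"
      unfolding sum.distrib[symmetric]
      by (intro sum.cong refl) (simp add: algebra_simps)
    then show "(\<Sum>k\<in>UNIV. cnj (U $ k $ i) * U $ k $ j * complex_of_real ((A + B) $ k $ i - (A + B) $ k $ j)) = 0"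
      using A B by (simp add: D_space_def)
  qed
qed (simp add: D_space_def)

text \<open>Closure under addition is not visible from the quadratic form \<open>Phi\<close>; it
  follows from the description by vanishing imaginary parts.\<close>

lemma subspace_E_space_flat_unitary:
  assumes "s > 0" and "\<And>i j. cmod (U $ i $ j) = 1 / s" and "conj_transpose U ** U = mat 1"
  shows "subspace (E_space U)"
  unfolding E_space_flat_unitary[OF assms]
proof (rule subspaceI)
  fix B C and c :: real
  let ?V = "{B. hermitian_matrix B \<and> (\<forall>i j. Im ((U ** B) $ i $ j * cnj (U $ i $ j)) = 0)}"
  assume B: "B \<in> ?V"
  have "Im ((U ** (c *\<^sub>R B)) $ i $ j * cnj (U $ i $ j)) = c * Im ((U ** B) $ i $ j * cnj (U $ i $ j))"
    for i j
    by (simp add: matrix_scalar_ac algebra_simps flip: scalar_matrix_assoc)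
  then show "c *\<^sub>R B \<in> ?V"
    using B by (simp add: hermitian_matrix_scaleR del: times_complex.sel)
  assume C: "C \<in> ?V"
  show "B + C \<in> ?V"
    using B C by (simp add: hermitian_matrix_add matrix_add_ldistrib distrib_right
        del: times_complex.sel)
qed (simp add: hermitian_matrix_def conj_transpose_def vec_eq_iff)

lemma bij_betw_flat_coords:
  fixes U :: "complex^'n^'n"
  assumes s: "s > 0" and norm: "\<And>i j. cmod (U $ i $ j) = 1 / s"
    and unitary: "conj_transpose U ** U = mat 1"
  shows "bij_betw (flat_coords U) (E_space U) (D_space U)"
proof -
  note E = E_space_flat_unitary[OF assms]
  \<comment> \<open>\<open>T A\<close> is the only possible value of \<open>U ** B\<close> with
    coordinates \<open>A\<close>: multiply \<open>(UB)\<^sub>i\<^sub>j cnj U\<^sub>i\<^sub>j =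
    A\<^sub>i\<^sub>j\<close> by \<open>U\<^sub>i\<^sub>j\<close> and use that its squared modulus
    is \<open>1/s\<^sup>2\<close>.\<close>
  define T :: "real^'n^'n \<Rightarrow> complex^'n^'n"
    where "T A = (\<chi> i j. complex_of_real (s\<^sup>2 * A $ i $ j) * U $ i $ j)" for A
  have unitary': "U ** conj_transpose U = mat 1"
    using unitary by (simp add: matrix_left_right_inverse)
  have UU: "U $ i $ j * cnj (U $ i $ j) = complex_of_real (1 / s\<^sup>2)" for i j
    by (simp add: norm power_divide flip: complex_norm_square)
  have eq_T: "T (flat_coords U B) = U ** B" if "B \<in> E_space U" for B
  proof -
    have "complex_of_real (flat_coords U B $ i $ j) = (U ** B) $ i $ j * cnj (U $ i $ j)" for i j
      using that E by (simp add: flat_coords_def complex_eq_iff)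
    then have "T (flat_coords U B) $ i $ j =
        complex_of_real (s\<^sup>2) * (U ** B) $ i $ j * (U $ i $ j * cnj (U $ i $ j))" for i j
      by (simp add: T_def)
    then show ?thesis
      using s by (simp add: vec_eq_iff UU)
  qed
  have T_coords: "T A $ i $ j * cnj (U $ i $ j) = complex_of_real (A $ i $ j)" for A i j
    using s by (simp add: T_def UU mult.assoc)
  have hermitian_iff: "hermitian_matrix (conj_transpose U ** T A) \<longleftrightarrow> A \<in> D_space U" for A
  proof -
    \<comment> \<open>Both entries are \<open>s\<^sup>2\<close> times a sum over \<open>k\<close>
      with weights \<open>cnj U\<^sub>k\<^sub>i U\<^sub>k\<^sub>j\<close>; since \<open>A\<close> is
      real, the adjoint merely replaces \<open>A\<^sub>k\<^sub>j\<close> by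
      \<open>A\<^sub>k\<^sub>i\<close>.\<close>
    have "(conj_transpose U ** T A) $ i $ j - conj_transpose (conj_transpose U ** T A) $ i $ j =
        - complex_of_real (s\<^sup>2) *
          (\<Sum>k\<in>UNIV. cnj (U $ k $ i) * U $ k $ j * complex_of_real (A $ k $ i - A $ k $ j))" for i j
      unfolding conj_transpose_def matrix_matrix_mult_def T_def sum_distrib_left
      by (simp add: sum_subtractf[symmetric] algebra_simps)
    then have "(conj_transpose U ** T A) $ i $ j = conj_transpose (conj_transpose U ** T A) $ i $ j
        \<longleftrightarrow> (\<Sum>k\<in>UNIV. cnj (U $ k $ i) * U $ k $ j * complex_of_real (A $ k $ i - A $ k $ j)) = 0"
      for i j
      unfolding eq_iff_diff_eq_0[of "(conj_transpose U ** T A) $ i $ j"] using s by simp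
    then show ?thesis
      by (simp add: hermitian_matrix_def D_space_def vec_eq_iff)
  qed
  have U_T: "U ** (conj_transpose U ** T A) = T A" for A
    by (simp add: matrix_mul_assoc unitary')
  have T_U: "conj_transpose U ** T (flat_coords U B) = B" if "B \<in> E_space U" for B
    by (simp add: eq_T[OF that] matrix_mul_assoc unitary)
  show ?thesis
  proof (rule bij_betw_byWitness[where f' = "\<lambda>A. conj_transpose U ** T A"])
    show "\<forall>B\<in>E_space U. conj_transpose U ** T (flat_coords U B) = B"
      using T_U by blast
    show "\<forall>A\<in>D_space U. flat_coords U (conj_transpose U ** T A) = A"
      by (simp add: flat_coords_def U_T T_coords vec_eq_iff del: times_complex.sel)
    \<comment> \<open>The candidate built from the coordinates of \<open>B\<close> is
      \<open>B\<close> itself, hence hermitian, so the criterion applies.\<close>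
    show "flat_coords U ` E_space U \<subseteq> D_space U"
      using T_U hermitian_iff by (force simp: E_space_def)
    \<comment> \<open>The imaginary parts vanish for every real \<open>A\<close> by
      \<open>T_coords\<close>; membership in \<open>D_space U\<close> is needed only for
      hermiticity.\<close>
    show "(\<lambda>A. conj_transpose U ** T A) ` D_space U \<subseteq> E_space U"
      by (auto simp: E hermitian_iff U_T T_coords simp del: times_complex.sel)
  qed
qed

theorem theorem8p3:
  fixes H U :: "complex^'n^'n"
  assumes "complex_hadamard H"
    and "U = (1 / sqrt (real CARD('n))) *\<^sub>R H"
  shows "(\<exists>f :: complex^'n^'n \<Rightarrow> real^'n^'n.
            (\<forall>B\<in>E_space U. \<forall>i j.
               complex_of_real (f B $ i $ j) = (U ** B) $ i $ j * cnj (U $ i $ j)) \<and>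
            real_iso_between f (E_space U) (D_space U)) \<and>
         dim (E_space U) = dim (D_space U)"
proof -
  have s: "sqrt (real CARD('n)) > 0"
    by simp
  note flat = s hadamard_unitary[OF assms]
  note bij = bij_betw_flat_coords[OF flat] and sub = subspace_E_space_flat_unitary[OF flat]
  have "\<forall>B\<in>E_space U. \<forall>i j.
      complex_of_real (flat_coords U B $ i $ j) = (U ** B) $ i $ j * cnj (U $ i $ j)"
    using E_space_flat_unitary[OF flat] by (simp add: flat_coords_def complex_eq_iff)
  moreover have "real_iso_between (flat_coords U) (E_space U) (D_space U)"
    using linear_flat_coords[of U] sub subspace_D_space bij
    by (simp add: real_iso_between_def linear_add linear_scale)
  \<comment> \<open>Preservation of dimension asks for injectivity on the span, which for the
    subspace \<open>E_space U\<close> is the set itself.\<close>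
  moreover have "dim (E_space U) = dim (D_space U)"
    using dim_image_eq[OF linear_flat_coords, of U "E_space U"] bij sub
    by (simp add: bij_betw_def span_eq_iff[THEN iffD2])
  ultimately show ?thesis
    by blast
qed

end
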